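(* Let $D$ be a digraph of order $n$. For every integer $k$ with $1\le k\le n-1$, $D$ is Eulerian if and only if $F_k(D)$ is Eulerian.
   Context: A digraph $D$ has a finite vertex set $V(D)$ and a set $A(D)$ of arcs, which are ordered pairs of distinct vertices (both $(x,y)$ and $(y,x)$ may be arcs). For a digraph $D$ of order $n$ and $1 \le k \le n-1$, the $k$-token digraph $F_k(D)$ has as vertices all $k$-subsets of $V(D)$, and $(A,B)$ is an arc of $F_k(D)$ whenever $A\setminus B=\{a\}$, $B\setminus A=\{b\}$ and $(a,b)\in A(D)$. A digraph is called Eulerian if $d^+(v)=d^-(v)$ for every vertex $v$, where $d^+(v)$ and $d^-(v)$ are the out-degree and in-degree of $v$ (no connectivity is required). *)

theory Defs
  imports "Graph_Theory.Pair_Digraph"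
begin

text \<open>Degree balance only: no connectivity and no closed Euler trail is required.\<close>
definition eulerian :: "('a, 'b) pre_digraph \<Rightarrow> bool" where
  "eulerian G \<longleftrightarrow> (\<forall>v \<in> verts G. out_degree G v = in_degree G v)"

definition token_digraph :: "nat \<Rightarrow> 'a pair_pre_digraph \<Rightarrow> 'a set pair_pre_digraph" where
  "token_digraph k D =
    \<lparr> pverts = {A. A \<subseteq> pverts D \<and> card A = k},
      parcs = {(A, B). A \<subseteq> pverts D \<and> card A = k \<and> B \<subseteq> pverts D \<and> card B = k \<and>
                 (\<exists>a b. A - B = {a} \<and> B - A = {b} \<and> (a, b) \<in> parcs D)} \<rparr>"

lemma pair_digraph_token_digraph:
  assumes "pair_digraph D"
  shows "pair_digraph (token_digraph k D)"
proof -
  have "finite (pverts D)"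
    using assms by (rule pair_fin_digraph.pair_finite_verts[OF pair_digraph.axioms(1)])
  then have fin: "finite (pverts (token_digraph k D))"
    by (simp add: token_digraph_def)
  have sub: "parcs (token_digraph k D) \<subseteq>
      pverts (token_digraph k D) \<times> pverts (token_digraph k D)"
    unfolding token_digraph_def by (simp, rule subsetI, clarify, simp)
  have ne: "fst e \<noteq> snd e" if "e \<in> parcs (token_digraph k D)" for e
    using that unfolding token_digraph_def
    by (cases e, clarify, simp only: fst_conv snd_conv pair_pre_digraph.simps, clarsimp)
  show ?thesis
  proof
    fix e assume e: "e \<in> parcs (token_digraph k D)"
    show "fst e \<in> pverts (token_digraph k D)"
      using subsetD[OF sub e] by (rule mem_Times_iff[THEN iffD1, THEN conjunct1])
    show "snd e \<in> pverts (token_digraph k D)"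
      using subsetD[OF sub e] by (rule mem_Times_iff[THEN iffD1, THEN conjunct2])
    show "fst e \<noteq> snd e"
      using e by (rule ne)
  next
    show "finite (pverts (token_digraph k D))" by (fact fin)
    show "finite (parcs (token_digraph k D))"
      by (rule finite_subset[OF sub finite_cartesian_product[OF fin fin]])
  qed
qed

end

theory Submission
  imports Defs
begin

text \<open>
  Call \<open>d\<^sup>+(v) - d\<^sup>-(v)\<close> the excess of \<open>v\<close>. An arc leaving a vertex \<open>A\<close> of the token digraph moves one
  token along an arc of \<open>D\<close> from \<open>A\<close> to its complement, and an arc entering \<open>A\<close> likewise comes from
  an arc of \<open>D\<close> from the complement into \<open>A\<close> (\<open>out_degree_token\<close>, \<open>in_degree_token\<close>). Arcs of \<open>D\<close>
  inside \<open>A\<close> contribute once to the out-degrees and once to the in-degrees of the members of \<open>A\<close>, so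
  they cancel, and the excess of \<open>A\<close> in the token digraph is the sum of the excesses of its members
  in \<open>D\<close> (\<open>token_excess\<close>).

  Hence the token digraph is Eulerian exactly if the excess function of \<open>D\<close> has zero sum over every
  \<open>k\<close>-subset of the vertices. As \<open>1 \<le> k < n\<close>, this forces the function to vanish: exchanging a
  single element of a \<open>k\<close>-subset shows that it is constant, and \<open>k\<close> times the constant is zero
  (\<open>zero_if_subset_sums_zero\<close>).
\<close>

definition excess :: "('a, 'b) pre_digraph \<Rightarrow> 'a \<Rightarrow> int" where
  "excess G v = int (out_degree G v) - int (in_degree G v)"

lemma eulerian_iff_excess: "eulerian G \<longleftrightarrow> (\<forall>v \<in> verts G. excess G v = 0)"
  by (simp add: eulerian_def excess_def)

text \<open>
  The arcs leaving \<open>A\<close> are parametrised by the arcs of \<open>D\<close> across the cut: the pair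
  \<open>(a, b)\<close> can be read off from the two differences \<open>A - B = {a}\<close> and \<open>B - A = {b}\<close>.
\<close>
lemma out_degree_token:
  assumes "pair_digraph D" and A: "A \<subseteq> pverts D" "card A = k"
  shows "out_degree (with_proj (token_digraph k D)) A
    = card {e \<in> parcs D. fst e \<in> A \<and> snd e \<notin> A}"
proof -
  interpret pair_digraph D by fact
  have fin: "finite A" using A finite_subset pair_finite_verts by blast
  let ?f = "\<lambda>(a, b). (A, insert b (A - {a}))"
  let ?C = "{e \<in> parcs D. fst e \<in> A \<and> snd e \<notin> A}"
  have inj: "inj_on ?f ?C"
  proof (rule inj_on_inverseI)
    fix e assume "e \<in> ?C"
    then obtain a b where e: "e = (a, b)" and ab: "a \<in> A" "b \<notin> A" by (cases e) auto
    have "A - insert b (A - {a}) = {a}" "insert b (A - {a}) - A = {b}"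
      using ab by auto
    then show "(\<lambda>(X, Y). (the_elem (X - Y), the_elem (Y - X))) (?f e) = e"
      by (simp add: e)
  qed
  have "?f ` ?C = out_arcs (with_proj (token_digraph k D)) A"
  proof (intro equalityI subsetI)
    fix e assume "e \<in> ?f ` ?C"
    then obtain a b where ab: "(a, b) \<in> parcs D" "a \<in> A" "b \<notin> A"
      and e: "e = (A, insert b (A - {a}))" by auto
    have "A - insert b (A - {a}) = {a}" "insert b (A - {a}) - A = {b}"
      using ab by auto
    moreover have "card (insert b (A - {a})) = k"
      using ab fin A(2) by (simp add: card_Suc_Diff1 del: card_Diff_singleton card_Diff_insert)
    moreover have "insert b (A - {a}) \<subseteq> pverts D"
      using ab(1) A(1) in_arcsD2 by auto
    ultimately show "e \<in> out_arcs (with_proj (token_digraph k D)) A"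
      using ab e A by (auto simp: token_digraph_def)
  next
    fix e assume "e \<in> out_arcs (with_proj (token_digraph k D)) A"
    then obtain a b B where "e = (A, B)" and ab: "A - B = {a}" "B - A = {b}" "(a, b) \<in> parcs D"
      by (cases e) (auto simp: token_digraph_def)
    moreover have "B = insert b (A - {a})" using ab by blast
    ultimately have "e = ?f (a, b)" by simp
    moreover have "a \<in> A" "b \<notin> A" using ab(1,2) by auto
    ultimately show "e \<in> ?f ` ?C"
      using ab(3) by (intro image_eqI[of _ _ "(a, b)"]) simp_all
  qed
  then show ?thesis
    unfolding out_degree_def using card_image[OF inj] by simp
qed

lemma in_degree_token:
  assumes "pair_digraph D" and A: "A \<subseteq> pverts D" "card A = k"
  shows "in_degree (with_proj (token_digraph k D)) A
    = card {e \<in> parcs D. fst e \<notin> A \<and> snd e \<in> A}"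
proof -
  interpret pair_digraph D by fact
  have fin: "finite A" using A finite_subset pair_finite_verts by blast
  let ?f = "\<lambda>(a, b). (insert a (A - {b}), A)"
  let ?C = "{e \<in> parcs D. fst e \<notin> A \<and> snd e \<in> A}"
  have inj: "inj_on ?f ?C"
  proof (rule inj_on_inverseI)
    fix e assume "e \<in> ?C"
    then obtain a b where e: "e = (a, b)" and ab: "a \<notin> A" "b \<in> A" by (cases e) auto
    have "insert a (A - {b}) - A = {a}" "A - insert a (A - {b}) = {b}"
      using ab by auto
    then show "(\<lambda>(X, Y). (the_elem (X - Y), the_elem (Y - X))) (?f e) = e"
      by (simp add: e)
  qed
  have "?f ` ?C = in_arcs (with_proj (token_digraph k D)) A"
  proof (intro equalityI subsetI)
    fix e assume "e \<in> ?f ` ?C"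
    then obtain a b where ab: "(a, b) \<in> parcs D" "a \<notin> A" "b \<in> A"
      and e: "e = (insert a (A - {b}), A)" by auto
    have "insert a (A - {b}) - A = {a}" "A - insert a (A - {b}) = {b}"
      using ab by auto
    moreover have "card (insert a (A - {b})) = k"
      using ab fin A(2) by (simp add: card_Suc_Diff1 del: card_Diff_singleton card_Diff_insert)
    moreover have "insert a (A - {b}) \<subseteq> pverts D"
      using ab(1) A(1) in_arcsD1 by auto
    ultimately show "e \<in> in_arcs (with_proj (token_digraph k D)) A"
      using ab e A by (auto simp: token_digraph_def)
  next
    fix e assume "e \<in> in_arcs (with_proj (token_digraph k D)) A"
    then obtain a b B where "e = (B, A)" and ab: "B - A = {a}" "A - B = {b}" "(a, b) \<in> parcs D"
      by (cases e) (auto simp: token_digraph_def)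
    moreover have "B = insert a (A - {b})" using ab by blast
    ultimately have "e = ?f (a, b)" by simp
    moreover have "a \<notin> A" "b \<in> A" using ab(1,2) by auto
    ultimately show "e \<in> ?f ` ?C"
      using ab(3) by (intro image_eqI[of _ _ "(a, b)"]) simp_all
  qed
  then show ?thesis
    unfolding in_degree_def using card_image[OF inj] by simp
qed

lemma sum_card_fibres:
  assumes "finite E" "finite A"
  shows "(\<Sum>v\<in>A. card {e \<in> E. f e = v}) = card {e \<in> E. f e \<in> A}"
proof -
  have "{e \<in> E. f e \<in> A} = (\<Union>v\<in>A. {e \<in> E. f e = v})" by auto
  also have "card \<dots> = (\<Sum>v\<in>A. card {e \<in> E. f e = v})"
    using assms by (intro card_UN_disjoint) auto
  finally show ?thesis by simp
qed

lemma card_split: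
  assumes "finite E"
  shows "card {e \<in> E. P e} = card {e \<in> E. P e \<and> Q e} + card {e \<in> E. P e \<and> \<not> Q e}"
proof -
  have "{e \<in> E. P e} = {e \<in> E. P e \<and> Q e} \<union> {e \<in> E. P e \<and> \<not> Q e}" by auto
  then show ?thesis using assms by (simp add: card_Un_disjoint disjoint_iff)
qed

text \<open>
  Summing the out-degrees over \<open>A\<close> counts all arcs with tail in \<open>A\<close>, summing the in-degrees all
  arcs with head in \<open>A\<close>; the arcs with both ends in \<open>A\<close> occur in both counts, and what remains is
  the cut that the degrees of \<open>A\<close> in the token digraph count.
\<close>
lemma token_excess:
  assumes "pair_digraph D" and A: "A \<subseteq> pverts D" "card A = k"
  shows "excess (with_proj (token_digraph k D)) A = (\<Sum>v\<in>A. excess (with_proj D) v)"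
proof -
  interpret pair_digraph D by fact
  have fin: "finite A" using A finite_subset pair_finite_verts by blast
  let ?E = "parcs D"
  have out: "(\<Sum>v\<in>A. out_degree (with_proj D) v)
      = card {e \<in> ?E. fst e \<in> A \<and> snd e \<in> A} + card {e \<in> ?E. fst e \<in> A \<and> snd e \<notin> A}"
    using sum_card_fibres[OF pair_finite_arcs fin, of fst]
      card_split[OF pair_finite_arcs, of "\<lambda>e. fst e \<in> A" "\<lambda>e. snd e \<in> A"]
    by (simp add: out_degree_def out_arcs_def)
  have inn: "(\<Sum>v\<in>A. in_degree (with_proj D) v)
      = card {e \<in> ?E. fst e \<in> A \<and> snd e \<in> A} + card {e \<in> ?E. fst e \<notin> A \<and> snd e \<in> A}"
    using sum_card_fibres[OF pair_finite_arcs fin, of snd]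
      card_split[OF pair_finite_arcs, of "\<lambda>e. snd e \<in> A" "\<lambda>e. fst e \<in> A"]
    by (simp add: in_degree_def in_arcs_def conj_commute)
  have "(\<Sum>v\<in>A. excess (with_proj D) v)
      = int (\<Sum>v\<in>A. out_degree (with_proj D) v) - int (\<Sum>v\<in>A. in_degree (with_proj D) v)"
    by (simp add: excess_def sum_subtractf)
  also have "\<dots> = excess (with_proj (token_digraph k D)) A"
    unfolding out inn excess_def out_degree_token[OF assms] in_degree_token[OF assms] by simp
  finally show ?thesis by simp
qed

text \<open>
  The bound \<open>k < card V\<close> leaves room for an element outside a \<open>k\<close>-subset, to be exchanged with
  one inside. For \<open>k = card V\<close> only the total sum would be known to vanish.
\<close>
lemma zero_if_subset_sums_zero:
  fixes f :: "'a \<Rightarrow> int"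
  assumes fin: "finite V" and k: "1 \<le> k" "k < card V"
    and sums: "\<And>A. A \<subseteq> V \<Longrightarrow> card A = k \<Longrightarrow> sum f A = 0"
    and v: "v \<in> V"
  shows "f v = 0"
proof -
  have const: "f u = f v" if u: "u \<in> V" for u
  proof (cases "u = v")
    case False
    have "card (V - {u, v}) = card V - 2"
      using False u v fin by (simp add: card_Diff_subset)
    then have "k - 1 \<le> card (V - {u, v})" using k by linarith
    then obtain S where S: "S \<subseteq> V - {u, v}" "card S = k - 1" "finite S"
      by (rule obtain_subset_with_card_n)
    have swap: "f w + sum f S = 0" if "w \<in> {u, v}" for w
    proof -
      have w: "w \<notin> S" "insert w S \<subseteq> V" using that S(1) u v by auto
      moreover have "card (insert w S) = k" using w S k by simp
      ultimately show ?thesis using sums[of "insert w S"] S(3) by simp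
    qed
    show ?thesis using swap[of u] swap[of v] by simp
  qed simp
  obtain A where A: "A \<subseteq> V" "card A = k"
    using k by (metis obtain_subset_with_card_n less_imp_le)
  have "sum f A = (\<Sum>u\<in>A. f v)" using const A(1) by (intro sum.cong) auto
  then have "int k * f v = 0" using sums[OF A] A(2) by simp
  then show ?thesis using k(1) by simp
qed

theorem theorem7p1:
  fixes D :: "'a pair_pre_digraph" and n k :: nat
  assumes "pair_digraph D"
    and "card (pverts D) = n"
    and "1 \<le> k" and "k \<le> n - 1"
  shows "eulerian (with_proj D) \<longleftrightarrow> eulerian (with_proj (token_digraph k D))"
proof -
  interpret pair_digraph D by fact
  let ?x = "excess (with_proj D)"
  have "eulerian (with_proj (token_digraph k D))
      \<longleftrightarrow> (\<forall>A. A \<subseteq> pverts D \<and> card A = k \<longrightarrow> sum ?x A = 0)"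
    using token_excess[OF assms(1)] by (auto simp: eulerian_iff_excess token_digraph_def)
  also have "\<dots> \<longleftrightarrow> (\<forall>v \<in> pverts D. ?x v = 0)"
  proof
    assume "\<forall>A. A \<subseteq> pverts D \<and> card A = k \<longrightarrow> sum ?x A = 0"
    moreover have "k < card (pverts D)" using assms(2-4) by linarith
    ultimately show "\<forall>v \<in> pverts D. ?x v = 0"
      using zero_if_subset_sums_zero[OF pair_finite_verts assms(3)] by blast
  next
    assume "\<forall>v \<in> pverts D. ?x v = 0"
    then show "\<forall>A. A \<subseteq> pverts D \<and> card A = k \<longrightarrow> sum ?x A = 0"
      by (auto intro!: sum.neutral)
  qed
  also have "\<dots> \<longleftrightarrow> eulerian (with_proj D)"
    by (simp add: eulerian_iff_excess)
  finally show ?thesis by simp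
qed

end
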